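(* Let $\alpha\in(0,1)$ and $\lambda\in[0,1]$. Let $\Omega_1$ be the set of feasible route flow vectors and, for $\mathbf{f}\in\Omega_1$, let $\psi_k^{rs}(\mathbf{f})$ be the $\alpha$-reliable combined mean travel time (with weight $\lambda$) of route $k\in K^{rs}$ under the flow $\mathbf{f}$. Assume that for all $r\in R$, $s\in S$, $k\in K^{rs}$ the function $\psi_k^{rs}$ is positive and continuous on $\Omega_1$. Then the combined mean traffic equilibrium model has at least one solution: there exists $\mathbf{f}^*\in\Omega_1$ such that, with $\pi_\alpha^{rs}=\min_{k\in K^{rs}}\psi_k^{rs}(\mathbf{f}^* )$, $$f_k^{rs*}\left(\psi_k^{rs}(\mathbf{f}^* )-\pi_\alpha^{rs}\right)=0,\qquad \psi_k^{rs}(\mathbf{f}^* )-\pi_\alpha^{rs}\ge 0,\qquad f_k^{rs*}\ge 0\qquad\text{for all } k\in K^{rs},\ r\in R,\ s\in S.$$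
   Context: Setting: a strongly connected transportation network $G=(N,A)$ with node set $N$ and link set $A$; $R,S\subseteq N$ are the sets of origins and destinations; $q^{rs}\ge 0$ is the given travel demand from $r\in R$ to $s\in S$; $K^{rs}$ is the finite nonempty set of routes from $r$ to $s$; $\delta_{ak}^{rs}=1$ if route $k\in K^{rs}$ uses link $a$, and $0$ otherwise. A route flow vector is $\mathbf{f}=(f_k^{rs})_{r\in R,\,s\in S,\,k\in K^{rs}}$. The feasible set is $$\Omega_1=\Big\{\mathbf{f}:\ \sum_{k\in K^{rs}}f_k^{rs}=q^{rs}\ \ \forall r\in R,\,s\in S;\quad f_k^{rs}\ge 0\ \ \forall k\in K^{rs},\,r\in R,\,s\in S\Big\},$$ with associated link flows $v_a=\sum_r\sum_s\sum_k f_k^{rs}\delta_{ak}^{rs}$ for $a\in A$. Route costs: the random link travel times $T_a$ have distributions depending on the link flows (hence on $\mathbf{f}$), and the random route travel time is $T_k^{rs}=\sum_{a\in A}T_a\delta_{ak}^{rs}$, assumed to have finite expectation for every $\mathbf{f}\in\Omega_1$. Put $\xi_k^{rs}(\alpha)=\min\{\xi\in\mathbb{R}:\Pr(T_k^{rs}\le\xi)\ge\alpha\}$ (percentile travel time), $\varphi_k^{rs}(\alpha)=E(T_k^{rs}\mid T_k^{rs}\le\xi_k^{rs}(\alpha))$ (mean-below travel time) and $\eta_k^{rs}(\alpha)=E(T_k^{rs}\mid T_k^{rs}\ge\xi_k^{rs}(\alpha))$ (mean-excess travel time). The $\alpha$-reliable combined mean travel time of route $k$ under flow $\mathbf{f}$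 is the convex combination $$\psi_k^{rs}(\mathbf{f})=\lambda\,\varphi_k^{rs}(\alpha)+(1-\lambda)\,\eta_k^{rs}(\alpha),$$ a real-valued function on $\Omega_1$. *)

theory Defs
  imports "HOL-Probability.Probability" "Graph_Theory.Graph_Theory"
begin

text \<open>A route is a directed walk, given by its list of links. It need not be a simple path, so a pair
  with equal origin and destination can be served by a round trip.\<close>

locale transport_network = fin_digraph G for G :: "('v, 'a) pre_digraph" (structure) +
  fixes R S :: "'v set"
    and q :: "'v \<Rightarrow> 'v \<Rightarrow> real"
    and K :: "'v \<Rightarrow> 'v \<Rightarrow> 'a list set"
  assumes strongly_connected: "strongly_connected G"
    and origins: "R \<subseteq> verts G"
    and destinations: "S \<subseteq> verts G"
    and demand_nonneg: "\<And>r s. r \<in> R \<Longrightarrow> s \<in> S \<Longrightarrow> 0 \<le> q r s"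
    and routes_finite: "\<And>r s. r \<in> R \<Longrightarrow> s \<in> S \<Longrightarrow> finite (K r s)"
    and routes_nonempty: "\<And>r s. r \<in> R \<Longrightarrow> s \<in> S \<Longrightarrow> K r s \<noteq> {}"
    and routes_walks: "\<And>r s k. r \<in> R \<Longrightarrow> s \<in> S \<Longrightarrow> k \<in> K r s \<Longrightarrow> awalk r k s"

text \<open>Flow vectors are extensional functions on the finite set of indices \<open>(r, s, k)\<close>. On such functions
  the pointwise topology of the function type is the Euclidean topology of the indexed vectors.\<close>

definition route_index ::
  "'v set \<Rightarrow> 'v set \<Rightarrow> ('v \<Rightarrow> 'v \<Rightarrow> 'a list set) \<Rightarrow> ('v \<times> 'v \<times> 'a list) set" where
  "route_index R S K = {(r, s, k). r \<in> R \<and> s \<in> S \<and> k \<in> K r s}"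

definition feasible_flows ::
  "'v set \<Rightarrow> 'v set \<Rightarrow> ('v \<Rightarrow> 'v \<Rightarrow> real) \<Rightarrow> ('v \<Rightarrow> 'v \<Rightarrow> 'a list set)
    \<Rightarrow> ('v \<times> 'v \<times> 'a list \<Rightarrow> real) set" where
  "feasible_flows R S q K =
     {f \<in> extensional (route_index R S K).
        (\<forall>r\<in>R. \<forall>s\<in>S. (\<Sum>k\<in>K r s. f (r, s, k)) = q r s) \<and>
        (\<forall>r\<in>R. \<forall>s\<in>S. \<forall>k\<in>K r s. 0 \<le> f (r, s, k))}"

definition incidence :: "'a \<Rightarrow> 'a list \<Rightarrow> real" where
  "incidence a k = (if a \<in> set k then 1 else 0)"

definition link_flows ::
  "('v, 'a) pre_digraph \<Rightarrow> 'v set \<Rightarrow> 'v set \<Rightarrow> ('v \<Rightarrow> 'v \<Rightarrow> 'a list set)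
    \<Rightarrow> ('v \<times> 'v \<times> 'a list \<Rightarrow> real) \<Rightarrow> 'a \<Rightarrow> real" where
  "link_flows G R S K f =
     (\<lambda>a\<in>arcs G. \<Sum>r\<in>R. \<Sum>s\<in>S. \<Sum>k\<in>K r s. f (r, s, k) * incidence a k)"

definition route_time ::
  "('v, 'a) pre_digraph \<Rightarrow> ('a \<Rightarrow> 'w \<Rightarrow> real) \<Rightarrow> 'a list \<Rightarrow> 'w \<Rightarrow> real" where
  "route_time G X k \<omega> = (\<Sum>a\<in>arcs G. X a \<omega> * incidence a k)"

text \<open>For link flows \<open>v\<close>, the link travel times are the random variables \<open>T v a\<close> on the probability
  space \<open>M v\<close>. Thus their joint distribution may depend on \<open>v\<close> in an arbitrary way.\<close>

locale stochastic_network = transport_network G R S q K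
  for G :: "('v, 'a) pre_digraph" (structure)
    and R S :: "'v set"
    and q :: "'v \<Rightarrow> 'v \<Rightarrow> real"
    and K :: "'v \<Rightarrow> 'v \<Rightarrow> 'a list set" +
  fixes M :: "('a \<Rightarrow> real) \<Rightarrow> 'w measure"
    and T :: "('a \<Rightarrow> real) \<Rightarrow> 'a \<Rightarrow> 'w \<Rightarrow> real"
  assumes prob_space: "\<And>f. f \<in> feasible_flows R S q K \<Longrightarrow> prob_space (M (link_flows G R S K f))"
    and link_time_measurable: "\<And>f a. f \<in> feasible_flows R S q K \<Longrightarrow> a \<in> arcs G \<Longrightarrow>
          T (link_flows G R S K f) a \<in> borel_measurable (M (link_flows G R S K f))"
    and route_time_integrable: "\<And>f r s k. f \<in> feasible_flows R S q K \<Longrightarrow>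
          r \<in> R \<Longrightarrow> s \<in> S \<Longrightarrow> k \<in> K r s \<Longrightarrow>
          integrable (M (link_flows G R S K f)) (route_time G (T (link_flows G R S K f)) k)"

definition percentile :: "'w measure \<Rightarrow> real \<Rightarrow> ('w \<Rightarrow> real) \<Rightarrow> real" where
  "percentile M \<alpha> X = (LEAST \<xi>. measure M {\<omega> \<in> space M. X \<omega> \<le> \<xi>} \<ge> \<alpha>)"

text \<open>The least element in this definition exists.\<close>

lemma percentile_attained:
  fixes X :: "'w \<Rightarrow> real"
  assumes "prob_space M" and X: "X \<in> borel_measurable M" and \<alpha>: "0 < \<alpha>" "\<alpha> < 1"
  shows "measure M {\<omega> \<in> space M. X \<omega> \<le> percentile M \<alpha> X} \<ge> \<alpha>"
    and "measure M {\<omega> \<in> space M. X \<omega> \<le> \<xi>} \<ge> \<alpha> \<Longrightarrow> percentile M \<alpha> X \<le> \<xi>"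
proof -
  interpret prob_space M by fact
  interpret D: real_distribution "distr M borel X"
    using X by (simp add: real_distribution_distr)
  let ?F = "cdf (distr M borel X)"
  have F: "?F x = measure M {\<omega> \<in> space M. X \<omega> \<le> x}" for x
    unfolding cdf_def using X
    by (subst measure_distr) (auto intro!: arg_cong[where f = "measure M"])
  let ?A = "{x. \<alpha> \<le> ?F x}"
  obtain b where b: "b \<in> ?A"
    using order_tendstoD(1)[OF D.cdf_lim_at_top_prob \<alpha>(2)]
    by (auto simp: eventually_at_top_linorder intro: less_imp_le)
  obtain c where c: "\<And>x. x \<le> c \<Longrightarrow> ?F x < \<alpha>"
    using order_tendstoD(2)[OF D.cdf_lim_at_bot \<alpha>(1)]
    by (auto simp: eventually_at_bot_linorder)
  have bdd: "bdd_below ?A"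
    by (rule bdd_belowI[of _ c]) (metis c linorder_not_le mem_Collect_eq nle_le)
  define m where "m = Inf ?A"
  have "\<alpha> \<le> ?F m"
  proof (rule tendsto_lowerbound)
    show "(?F \<longlongrightarrow> ?F m) (at_right m)"
      using D.cdf_is_right_cont[of m] by (simp add: continuous_within)
    have "\<alpha> \<le> ?F x" if x: "m < x" for x
    proof -
      obtain y where "y \<in> ?A" "y < x"
        using x b cInf_lessD[of ?A x] unfolding m_def by auto
      then show ?thesis using D.cdf_nondecreasing[of y x] by auto
    qed
    then show "\<forall>\<^sub>F x in at_right m. \<alpha> \<le> ?F x"
      by (auto simp: eventually_at_right_field intro: exI[of _ "m + 1"])
  qed simp
  moreover have low: "m \<le> x" if "\<alpha> \<le> ?F x" for x
    unfolding m_def using bdd that by (auto intro: cInf_lower)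
  ultimately have m: "percentile M \<alpha> X = m"
    unfolding percentile_def F[symmetric] by (intro Least_equality)
  show "measure M {\<omega> \<in> space M. X \<omega> \<le> percentile M \<alpha> X} \<ge> \<alpha>"
    using \<open>\<alpha> \<le> ?F m\<close> by (simp add: m F)
  show "measure M {\<omega> \<in> space M. X \<omega> \<le> \<xi>} \<ge> \<alpha> \<Longrightarrow> percentile M \<alpha> X \<le> \<xi>"
    using low by (simp add: m F)
qed

text \<open>Conditional expectation given an event. Both events conditioned on below have positive
  probability when \<open>0 < \<alpha> < 1\<close>.\<close>

definition cond_expectation :: "'w measure \<Rightarrow> ('w \<Rightarrow> real) \<Rightarrow> 'w set \<Rightarrow> real" where
  "cond_expectation M X B = (LINT \<omega>:B|M. X \<omega>) / measure M B"

definition mean_below :: "'w measure \<Rightarrow> real \<Rightarrow> ('w \<Rightarrow> real) \<Rightarrow> real" where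
  "mean_below M \<alpha> X = cond_expectation M X {\<omega> \<in> space M. X \<omega> \<le> percentile M \<alpha> X}"

definition mean_excess :: "'w measure \<Rightarrow> real \<Rightarrow> ('w \<Rightarrow> real) \<Rightarrow> real" where
  "mean_excess M \<alpha> X = cond_expectation M X {\<omega> \<in> space M. X \<omega> \<ge> percentile M \<alpha> X}"

definition combined_mean :: "'w measure \<Rightarrow> real \<Rightarrow> real \<Rightarrow> ('w \<Rightarrow> real) \<Rightarrow> real" where
  "combined_mean M \<alpha> lam X = lam * mean_below M \<alpha> X + (1 - lam) * mean_excess M \<alpha> X"

definition route_cost ::
  "('v, 'a) pre_digraph \<Rightarrow> 'v set \<Rightarrow> 'v set \<Rightarrow> ('v \<Rightarrow> 'v \<Rightarrow> 'a list set)
    \<Rightarrow> (('a \<Rightarrow> real) \<Rightarrow> 'w measure) \<Rightarrow> (('a \<Rightarrow> real) \<Rightarrow> 'a \<Rightarrow> 'w \<Rightarrow> real)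
    \<Rightarrow> real \<Rightarrow> real \<Rightarrow> 'a list \<Rightarrow> ('v \<times> 'v \<times> 'a list \<Rightarrow> real) \<Rightarrow> real" where
  "route_cost G R S K M T \<alpha> lam k f =
     (let v = link_flows G R S K f in combined_mean (M v) \<alpha> lam (route_time G (T v) k))"

definition combined_mean_equilibrium ::
  "('v, 'a) pre_digraph \<Rightarrow> 'v set \<Rightarrow> 'v set \<Rightarrow> ('v \<Rightarrow> 'v \<Rightarrow> real) \<Rightarrow> ('v \<Rightarrow> 'v \<Rightarrow> 'a list set)
    \<Rightarrow> (('a \<Rightarrow> real) \<Rightarrow> 'w measure) \<Rightarrow> (('a \<Rightarrow> real) \<Rightarrow> 'a \<Rightarrow> 'w \<Rightarrow> real)
    \<Rightarrow> real \<Rightarrow> real \<Rightarrow> ('v \<times> 'v \<times> 'a list \<Rightarrow> real) \<Rightarrow> bool" where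
  "combined_mean_equilibrium G R S q K M T \<alpha> lam f \<longleftrightarrow>
     f \<in> feasible_flows R S q K \<and>
     (\<forall>r\<in>R. \<forall>s\<in>S.
        let \<pi> = Min ((\<lambda>k. route_cost G R S K M T \<alpha> lam k f) ` K r s)
        in \<forall>k\<in>K r s.
             f (r, s, k) * (route_cost G R S K M T \<alpha> lam k f - \<pi>) = 0 \<and>
             route_cost G R S K M T \<alpha> lam k f - \<pi> \<ge> 0 \<and>
             f (r, s, k) \<ge> 0)"

end

theory Submission
  imports Defs
begin

text \<open>Write the flow between each origin-destination pair as the demand times a vector of route shares.
  The shares range over a product of simplices, which is a retract of a cube, and an equilibrium is a
  fixed point of Nash's map: it moves weight towards the routes that are cheaper than the average
  of their pair. The number of routes is not encoded in a type, so Brouwer's theorem is derived for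
  cubes of functions on a finite set, from Kuhn's combinatorial lemma.\<close>

section \<open>Brouwer's fixed point theorem on cubes of functions\<close>

lemma compact_PiE_UNIV:
  fixes A :: "'i \<Rightarrow> 'b::topological_space set"
  assumes "\<And>i. compact (A i)"
  shows "compact (PiE UNIV A)"
  using assms compactin_PiE[of "\<lambda>_. euclidean" UNIV A]
  by (simp add: euclidean_product_topology)

lemma tendsto_coordinatewise_fun:
  fixes f :: "'a \<Rightarrow> 'i \<Rightarrow> 'b::topological_space"
  shows "(f \<longlongrightarrow> l) F \<longleftrightarrow> (\<forall>i. ((\<lambda>x. f x i) \<longlongrightarrow> l i) F)"
  using limitin_componentwise[of "\<lambda>_. euclidean :: 'b topology" UNIV f l F]
  by (simp add: euclidean_product_topology)

text \<open>Kuhn's lemma on the grid of mesh \<open>1 / p\<close>, with labels telling whether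
  \<open>h\<close> moves a coordinate up or down. It gives a cell in which every coordinate below
  \<open>n\<close> carries both labels. The witnesses \<open>a\<close> and \<open>b\<close> may
  differ from one \<open>i\<close> to the next; this does no harm, as all of them lie near the same
  \<open>z\<close>.\<close>

lemma approximate_fixed_point:
  fixes h :: "(nat \<Rightarrow> real) \<Rightarrow> nat \<Rightarrow> real"
  assumes h01: "\<And>x i. x \<in> PiE UNIV (\<lambda>_. {0..1}) \<Longrightarrow> i < n \<Longrightarrow> h x i \<in> {0..1}"
    and p: "0 < p"
  obtains z where "z \<in> PiE UNIV (\<lambda>_. {0..1})"
    and "\<And>i. i < n \<Longrightarrow> \<exists>a b. a \<in> PiE UNIV (\<lambda>_. {0..1}) \<and> b \<in> PiE UNIV (\<lambda>_. {0..1}) \<and>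
           (\<forall>j. \<bar>a j - z j\<bar> \<le> 1 / real p) \<and> (\<forall>j. \<bar>b j - z j\<bar> \<le> 1 / real p) \<and>
           a i \<le> h a i \<and> h b i \<le> b i"
proof -
  \<comment> \<open>Setting the coordinates from \<open>n\<close> on to 0 keeps grid points in the
    cube and makes the distance bounds hold for every \<open>j\<close>.\<close>
  define pt where "pt x = (\<lambda>j. if j < n then real (x j) / real p else 0)" for x :: "nat \<Rightarrow> nat"
  \<comment> \<open>The conjunct \<open>x i < p\<close> forces label 1 on the upper face, as Kuhn's
    lemma demands, even where \<open>h\<close> does not decrease the coordinate. Label 0 on the
    lower face comes from \<open>h\<close> being nonnegative.\<close>
  define label where "label x i = (if x i < p \<and> pt x i \<le> h (pt x) i then 0 else 1 :: nat)" for x i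
  have pt: "pt x \<in> PiE UNIV (\<lambda>_. {0..1})" if "\<forall>i<n. x i \<le> p" for x
    using that p by (auto simp: pt_def)
  obtain u where u: "\<forall>i<n. u i < p"
    and uu: "\<forall>i<n. \<exists>r s. (\<forall>j<n. u j \<le> r j \<and> r j \<le> u j + 1) \<and>
               (\<forall>j<n. u j \<le> s j \<and> s j \<le> u j + 1) \<and> label r i \<noteq> label s i"
  proof (rule kuhn_lemma[of p n label])
    show "\<forall>x. (\<forall>i<n. x i \<le> p) \<longrightarrow> (\<forall>i<n. x i = 0 \<longrightarrow> label x i = 0)"
    proof (intro allI impI)
      fix x i assume x: "\<forall>i<n. x i \<le> p" and i: "i < n" "x i = 0"
      show "label x i = 0"
        using h01[OF pt[OF x] i(1)] i p by (simp add: label_def pt_def)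
    qed
  qed (use p in \<open>simp_all add: label_def\<close>)
  have near: "\<bar>pt r j - pt u j\<bar> \<le> 1 / real p" if "\<forall>j<n. u j \<le> r j \<and> r j \<le> u j + 1" for r j
  proof (cases "j < n")
    case True
    then have "\<bar>real (r j) - real (u j)\<bar> \<le> 1"
      using that by (auto simp: abs_if)
    then have "\<bar>real (r j) - real (u j)\<bar> / real p \<le> 1 / real p"
      by (simp add: divide_right_mono)
    then show ?thesis
      using True p by (simp add: pt_def flip: diff_divide_distrib)
  qed (simp add: pt_def)
  show ?thesis
  proof (rule that)
    show "pt u \<in> PiE UNIV (\<lambda>_. {0..1})"
      using u by (simp add: pt less_imp_le)
    fix i assume i: "i < n"
    obtain r s where r: "\<forall>j<n. u j \<le> r j \<and> r j \<le> u j + 1"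
      and s: "\<forall>j<n. u j \<le> s j \<and> s j \<le> u j + 1" and "label r i \<noteq> label s i"
      using uu i by blast
    then have "label r i = 0 \<and> label s i = 1 \<or> label s i = 0 \<and> label r i = 1"
      by (simp add: label_def split: if_splits)
    then obtain a b where a: "\<forall>j<n. u j \<le> a j \<and> a j \<le> u j + 1" "label a i = 0"
      and b: "\<forall>j<n. u j \<le> b j \<and> b j \<le> u j + 1" "label b i = 1"
      using r s by blast
    have le_p: "\<forall>j<n. r j \<le> p" if "\<forall>j<n. u j \<le> r j \<and> r j \<le> u j + 1" for r
      using that u by (metis Suc_eq_plus1 Suc_leI le_trans)
    note aC = pt[OF le_p[OF a(1)]] and bC = pt[OF le_p[OF b(1)]]
    \<comment> \<open>Label 1 at \<open>b\<close> has two possible causes: either \<open>h\<close>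
      decreases the coordinate, or the point is on the upper face, where the coordinate is 1 and
      \<open>h\<close> is at most 1.\<close>
    have "b i = p" if "\<not> b i < p"
      using that le_p[OF b(1)] i by (simp add: le_antisym)
    then have "h (pt b) i \<le> pt b i"
      using b(2) h01[OF bC i] p i by (force simp: label_def pt_def split: if_splits)
    moreover have "pt a i \<le> h (pt a) i"
      using a(2) by (simp add: label_def split: if_splits)
    ultimately show "\<exists>a b. a \<in> PiE UNIV (\<lambda>_. {0..1}) \<and> b \<in> PiE UNIV (\<lambda>_. {0..1}) \<and>
           (\<forall>j. \<bar>a j - pt u j\<bar> \<le> 1 / real p) \<and> (\<forall>j. \<bar>b j - pt u j\<bar> \<le> 1 / real p) \<and>
           a i \<le> h a i \<and> h b i \<le> b i"
      using aC bC near[OF a(1)] near[OF b(1)] by blast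
  qed
qed

text \<open>Let the mesh tend to 0. Along a subsequence the points \<open>z\<close> converge, and
  the witnesses \<open>a\<close> and \<open>b\<close> are dragged to the same limit. By continuity
  both inequalities survive there, and together they give equality.\<close>

lemma brouwer_cube_nat:
  fixes h :: "(nat \<Rightarrow> real) \<Rightarrow> nat \<Rightarrow> real"
  assumes cont: "\<And>i. i < n \<Longrightarrow> continuous_on (PiE UNIV (\<lambda>_. {0..1})) (\<lambda>x. h x i)"
    and h01: "\<And>x i. x \<in> PiE UNIV (\<lambda>_. {0..1}) \<Longrightarrow> i < n \<Longrightarrow> h x i \<in> {0..1}"
  obtains x where "x \<in> PiE UNIV (\<lambda>_. {0..1})" and "\<And>i. i < n \<Longrightarrow> h x i = x i"
proof -
  let ?C = "PiE UNIV (\<lambda>_. {0..1}) :: (nat \<Rightarrow> real) set"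
  have "\<exists>z. z \<in> ?C \<and> (\<forall>i<n. \<exists>a b. a \<in> ?C \<and> b \<in> ?C \<and>
           (\<forall>j. \<bar>a j - z j\<bar> \<le> 1 / real (Suc m)) \<and> (\<forall>j. \<bar>b j - z j\<bar> \<le> 1 / real (Suc m)) \<and>
           a i \<le> h a i \<and> h b i \<le> b i)" for m
    using approximate_fixed_point[of n h "Suc m", OF h01] by (metis zero_less_Suc)
  then obtain z where zC: "\<And>m. z m \<in> ?C"
    and z: "\<And>m i. i < n \<Longrightarrow> \<exists>a b. a \<in> ?C \<and> b \<in> ?C \<and>
           (\<forall>j. \<bar>a j - z m j\<bar> \<le> 1 / real (Suc m)) \<and> (\<forall>j. \<bar>b j - z m j\<bar> \<le> 1 / real (Suc m)) \<and>
           a i \<le> h a i \<and> h b i \<le> b i"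
    by metis
  \<comment> \<open>Indexing by \<open>nat\<close> matters here: a countable product is first
    countable, so compactness yields convergent subsequences.\<close>
  have "seq_compact ?C"
    by (intro compact_imp_seq_compact compact_PiE_UNIV) simp
  then obtain l \<sigma> where l: "l \<in> ?C" and \<sigma>: "strict_mono \<sigma>" and lim: "(z \<circ> \<sigma>) \<longlonglongrightarrow> l"
    using zC by (metis seq_compactE)
  have close: "(\<lambda>m. a (\<sigma> m)) \<longlonglongrightarrow> l" if "\<And>m j. \<bar>a m j - z m j\<bar> \<le> 1 / real (Suc m)" for a
    unfolding tendsto_coordinatewise_fun
  proof
    fix j
    have "(\<lambda>m. a m j - z m j) \<longlonglongrightarrow> 0"
      using LIMSEQ_Suc[OF lim_1_over_n]
      by (rule Lim_null_comparison[rotated]) (use that in auto)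
    then have "(\<lambda>m. a (\<sigma> m) j - z (\<sigma> m) j) \<longlonglongrightarrow> 0"
      using LIMSEQ_subseq_LIMSEQ[OF _ \<sigma>] by (force simp: o_def)
    moreover have "(\<lambda>m. z (\<sigma> m) j) \<longlonglongrightarrow> l j"
      using lim by (simp add: tendsto_coordinatewise_fun)
    ultimately show "(\<lambda>m. a (\<sigma> m) j) \<longlonglongrightarrow> l j"
      using tendsto_add by fastforce
  qed
  have "h l i = l i" if i: "i < n" for i
  proof -
    obtain a b where ab: "\<And>m. a m \<in> ?C" "\<And>m. b m \<in> ?C"
      and near: "\<And>m j. \<bar>a m j - z m j\<bar> \<le> 1 / real (Suc m)" "\<And>m j. \<bar>b m j - z m j\<bar> \<le> 1 / real (Suc m)"
      and le: "\<And>m. a m i \<le> h (a m) i" "\<And>m. h (b m) i \<le> b m i"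
      using z[OF i] by metis
    note lims = close[OF near(1)] close[OF near(2)]
    have "(\<lambda>m. h (a (\<sigma> m)) i) \<longlonglongrightarrow> h l i" "(\<lambda>m. h (b (\<sigma> m)) i) \<longlonglongrightarrow> h l i"
      by (rule continuous_on_tendsto_compose[OF cont[OF i] lims(1) l],
          rule always_eventually, rule allI, rule ab)
         (rule continuous_on_tendsto_compose[OF cont[OF i] lims(2) l],
          rule always_eventually, rule allI, rule ab)
    moreover have "(\<lambda>m. a (\<sigma> m) i) \<longlonglongrightarrow> l i" "(\<lambda>m. b (\<sigma> m) i) \<longlonglongrightarrow> l i"
      using lims by (simp_all add: tendsto_coordinatewise_fun)
    ultimately show ?thesis
      using le by (meson LIMSEQ_le antisym)
  qed
  with l show ?thesis by (rule that)
qed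

lemma brouwer_cube_fun:
  fixes h :: "('i \<Rightarrow> real) \<Rightarrow> 'i \<Rightarrow> real"
  assumes "finite I"
    and cont: "\<And>i. i \<in> I \<Longrightarrow> continuous_on (PiE I (\<lambda>_. {0..1})) (\<lambda>x. h x i)"
    and h01: "\<And>x i. x \<in> PiE I (\<lambda>_. {0..1}) \<Longrightarrow> i \<in> I \<Longrightarrow> h x i \<in> {0..1}"
  obtains x where "x \<in> PiE I (\<lambda>_. {0..1})" and "\<And>i. i \<in> I \<Longrightarrow> h x i = x i"
proof -
  obtain e where e: "bij_betw e {..<card I} I"
    using ex_bij_betw_nat_finite[OF \<open>finite I\<close>] by (auto simp: atLeast0LessThan)
  define d where "d = the_inv_into {..<card I} e"
  have d: "d i < card I" "e (d i) = i" if "i \<in> I" for i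
    using that e bij_betwE[OF bij_betw_the_inv_into[OF e]]
    by (auto simp: d_def f_the_inv_into_f_bij_betw)
  have eI: "e j \<in> I" "d (e j) = j" if "j < card I" for j
    using that e by (auto simp: d_def bij_betw_def the_inv_into_f_f)
  \<comment> \<open>\<open>\<Phi>\<close> reads the first \<open>card I\<close> terms of a sequence
    as a function on \<open>I\<close>, numbered by \<open>e\<close>. The later terms are ignored,
    which fits a fixed point equation that only concerns indices below
    \<open>card I\<close>.\<close>
  define \<Phi> where "\<Phi> x = (\<lambda>i\<in>I. x (d i))" for x :: "nat \<Rightarrow> real"
  have \<Phi>: "\<Phi> x \<in> PiE I (\<lambda>_. {0..1})" if "x \<in> PiE UNIV (\<lambda>_. {0..1})" for x
    using that by (auto simp: \<Phi>_def PiE_iff)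
  have cont_\<Phi>: "continuous_on A \<Phi>" for A
    unfolding \<Phi>_def restrict_def
  proof (intro continuous_on_coordinatewise_then_product)
    fix i show "continuous_on A (\<lambda>x. if i \<in> I then x (d i) else undefined :: real)"
      by (cases "i \<in> I") (auto intro: continuous_on_subset[OF continuous_on_product_coordinates])
  qed
  obtain x where x: "x \<in> PiE UNIV (\<lambda>_. {0..1})" "\<And>j. j < card I \<Longrightarrow> h (\<Phi> x) (e j) = x j"
  proof (rule brouwer_cube_nat[of "card I" "\<lambda>x j. h (\<Phi> x) (e j)"])
    show "continuous_on (PiE UNIV (\<lambda>_. {0..1})) (\<lambda>x. h (\<Phi> x) (e j))" if "j < card I" for j
      using continuous_on_compose2[OF cont[OF eI(1)[OF that]] cont_\<Phi>] \<Phi> by blast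
  qed (use h01 \<Phi> eI in blast)+
  show ?thesis
  proof (rule that)
    show "\<Phi> x \<in> PiE I (\<lambda>_. {0..1})" using x \<Phi> by blast
    show "h (\<Phi> x) i = \<Phi> x i" if "i \<in> I" for i
      using x(2)[OF d(1)[OF that]] d(2)[OF that] that by (simp add: \<Phi>_def)
  qed
qed

section \<open>Products of simplices as retracts of cubes\<close>

definition simplex_product :: "'g set \<Rightarrow> ('g \<Rightarrow> 'k set) \<Rightarrow> ('g \<times> 'k \<Rightarrow> real) set" where
  "simplex_product P K =
     {y \<in> PiE (Sigma P K) (\<lambda>_. {0..}). \<forall>p\<in>P. (\<Sum>k\<in>K p. y (p, k)) = 1}"

lemma simplex_product_le_1:
  assumes "y \<in> simplex_product P K" "p \<in> P" "k \<in> K p" "finite (K p)"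
  shows "y (p, k) \<le> 1"
proof -
  have "y (p, k) \<le> (\<Sum>k\<in>K p. y (p, k))"
    using assms by (intro member_le_sum) (auto simp: simplex_product_def PiE_iff)
  then show ?thesis using assms by (simp add: simplex_product_def)
qed

text \<open>A point of coordinate sum at least 1 is rescaled, any other is shifted along the diagonal.\<close>

definition simplex_retraction ::
    "'g set \<Rightarrow> ('g \<Rightarrow> 'k set) \<Rightarrow> ('g \<times> 'k \<Rightarrow> real) \<Rightarrow> 'g \<times> 'k \<Rightarrow> real" where
  "simplex_retraction P K x =
     (\<lambda>(p, k)\<in>Sigma P K. (x (p, k) + max 0 (1 - (\<Sum>j\<in>K p. x (p, j))) / card (K p))
        / max 1 (\<Sum>j\<in>K p. x (p, j)))"

lemma simplex_retraction_mem:
  assumes fin: "\<And>p. p \<in> P \<Longrightarrow> finite (K p)" and ne: "\<And>p. p \<in> P \<Longrightarrow> K p \<noteq> {}"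
    and x: "x \<in> PiE (Sigma P K) (\<lambda>_. {0..1})"
  shows "simplex_retraction P K x \<in> simplex_product P K"
proof -
  have "(\<Sum>k\<in>K p. simplex_retraction P K x (p, k)) = 1" if p: "p \<in> P" for p
  proof -
    let ?s = "\<Sum>j\<in>K p. x (p, j)"
    \<comment> \<open>The shift is split evenly over the nonempty set \<open>K p\<close>, so
      \<open>card (K p)\<close> cancels. Numerator and denominator then both equal
      \<open>max 1 ?s\<close>.\<close>
    have "(\<Sum>k\<in>K p. simplex_retraction P K x (p, k)) = (?s + max 0 (1 - ?s)) / max 1 ?s"
      using fin[OF p] ne[OF p] p
      by (simp add: simplex_retraction_def sum.distrib flip: sum_divide_distrib)
    also have "\<dots> = 1" by (auto simp: max_def)
    finally show ?thesis .
  qed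
  moreover have "simplex_retraction P K x \<in> PiE (Sigma P K) (\<lambda>_. {0..})"
    using x by (auto simp: simplex_retraction_def PiE_iff)
  ultimately show ?thesis by (simp add: simplex_product_def)
qed

lemma simplex_retraction_id:
  assumes "x \<in> simplex_product P K"
  shows "simplex_retraction P K x = x"
  using assms by (auto simp: simplex_product_def simplex_retraction_def PiE_iff extensional_def)

lemma continuous_on_coordinate: "continuous_on A (\<lambda>x. x i :: 'b::topological_space)"
  by (rule continuous_on_subset[OF continuous_on_product_coordinates]) simp

lemma continuous_on_simplex_retraction:
  assumes "\<And>p. p \<in> P \<Longrightarrow> finite (K p)" "\<And>p. p \<in> P \<Longrightarrow> K p \<noteq> {}"
  shows "continuous_on A (simplex_retraction P K)"
  unfolding simplex_retraction_def restrict_def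
proof (intro continuous_on_coordinatewise_then_product)
  fix i :: "'a \<times> 'b"
  obtain p k where i: "i = (p, k)" by force
  \<comment> \<open>Since the divisor never vanishes, the quotient is continuous across the border
    between shifting and rescaling.\<close>
  have "max 1 t \<noteq> 0" for t :: real by linarith
  then show "continuous_on A (\<lambda>x. if i \<in> Sigma P K then (case i of (p, k) \<Rightarrow>
     (x (p, k) + max 0 (1 - (\<Sum>j\<in>K p. x (p, j))) / card (K p))
        / max 1 (\<Sum>j\<in>K p. x (p, j))) else undefined)"
    unfolding i using assms by (cases "(p, k) \<in> Sigma P K")
      (auto intro!: continuous_intros continuous_on_coordinate)
qed

section \<open>Equilibria on a product of simplices by Nash's map\<close>

lemma simplex_product_equilibrium:
  fixes c :: "'g \<Rightarrow> 'k \<Rightarrow> ('g \<times> 'k \<Rightarrow> real) \<Rightarrow> real"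
  assumes "finite P"
    and fin: "\<And>p. p \<in> P \<Longrightarrow> finite (K p)" and ne: "\<And>p. p \<in> P \<Longrightarrow> K p \<noteq> {}"
    and cont: "\<And>p k. p \<in> P \<Longrightarrow> k \<in> K p \<Longrightarrow> continuous_on (simplex_product P K) (c p k)"
  obtains y where "y \<in> simplex_product P K"
    and "\<And>p k j. p \<in> P \<Longrightarrow> k \<in> K p \<Longrightarrow> j \<in> K p \<Longrightarrow> y (p, k) > 0 \<Longrightarrow> c p k y \<le> c p j y"
proof -
  let ?D = "simplex_product P K" and ?C = "PiE (Sigma P K) (\<lambda>_. {0..1::real})"
  \<comment> \<open>\<open>avg\<close> is the mean cost under the shares \<open>y\<close>, and
    \<open>gain\<close> is the amount by which an alternative undercuts it. \<open>nash\<close> adds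
    the gains to the shares and normalises each block again.\<close>
  define avg where "avg p y = (\<Sum>j\<in>K p. y (p, j) * c p j y)" for p y
  define gain where "gain p k y = max 0 (avg p y - c p k y)" for p k y
  define nash where "nash y = (\<lambda>(p, k). (y (p, k) + gain p k y) / (1 + (\<Sum>j\<in>K p. gain p j y)))" for y
  have gain_nonneg: "0 \<le> gain p k y" for p k y by (simp add: gain_def)
  have pos: "0 < 1 + (\<Sum>j\<in>K p. gain p j y)" for p y
    using sum_nonneg[of "K p" "\<lambda>j. gain p j y"] gain_nonneg by force
  have cont_gain: "continuous_on ?D (gain p k)" if "p \<in> P" "k \<in> K p" for p k
    unfolding gain_def avg_def using that cont
    by (intro continuous_intros continuous_on_coordinate) auto
  have cont_nash: "continuous_on ?D (\<lambda>y. nash y (p, k))" if "p \<in> P" "k \<in> K p" for p k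
    unfolding nash_def using that cont_gain less_imp_neq[OF pos]
    by (auto intro!: continuous_intros continuous_on_coordinate)
  have nash01: "nash y (p, k) \<in> {0..1}" if "y \<in> ?D" "p \<in> P" "k \<in> K p" for y p k
  proof -
    \<comment> \<open>Numerator and denominator are compared term by term: the share with 1, the
      gain with the sum of the gains.\<close>
    have "gain p k y \<le> (\<Sum>j\<in>K p. gain p j y)"
      using that fin gain_nonneg by (intro member_le_sum) auto
    moreover have "0 \<le> y (p, k)" "y (p, k) \<le> 1"
      using that simplex_product_le_1[OF that fin] by (auto simp: simplex_product_def PiE_iff)
    ultimately show ?thesis
      using gain_nonneg[of p k y] pos[of p y] by (simp add: nash_def)
  qed
  have retr: "simplex_retraction P K x \<in> ?D" if "x \<in> ?C" for x
    using fin ne that by (rule simplex_retraction_mem)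
  have cont_retr: "continuous_on ?C (simplex_retraction P K)"
    using fin ne by (rule continuous_on_simplex_retraction)
  \<comment> \<open>Brouwer's theorem is available on the cube, whereas the costs are continuous
    only on the simplices; retracting before applying \<open>nash\<close> bridges the gap.\<close>
  obtain x where x: "x \<in> ?C"
    and fixed: "\<And>i. i \<in> Sigma P K \<Longrightarrow> nash (simplex_retraction P K x) i = x i"
  proof (rule brouwer_cube_fun[of "Sigma P K" "\<lambda>x. nash (simplex_retraction P K x)"])
    show "finite (Sigma P K)" using \<open>finite P\<close> fin by blast
    show "continuous_on ?C (\<lambda>x. nash (simplex_retraction P K x) i)" if "i \<in> Sigma P K" for i
    proof -
      obtain p k where "i = (p, k)" "p \<in> P" "k \<in> K p" using \<open>i \<in> Sigma P K\<close> by blast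
      then show ?thesis
        using continuous_on_compose2[OF cont_nash cont_retr] retr by auto
    qed
    show "nash (simplex_retraction P K x) i \<in> {0..1}" if "x \<in> ?C" "i \<in> Sigma P K" for x i
      using nash01[OF retr[OF that(1)]] that(2) by auto
  qed blast
  define y where "y = simplex_retraction P K x"
  have y: "y \<in> ?D" unfolding y_def by (rule retr[OF x])
  \<comment> \<open>\<open>nash\<close> preserves block sums equal to 1, so the fixed point
    \<open>x\<close> of the composite already lies in the product of simplices. The retraction
    leaves it alone, and \<open>x\<close> is fixed by \<open>nash\<close> itself.\<close>
  have "(\<Sum>k\<in>K p. x (p, k)) = 1" if p: "p \<in> P" for p
  proof -
    have "(\<Sum>k\<in>K p. x (p, k)) = (\<Sum>k\<in>K p. nash y (p, k))"
      using p fixed by (intro sum.cong) (auto simp: y_def)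
    also have "\<dots> = (1 + (\<Sum>j\<in>K p. gain p j y)) / (1 + (\<Sum>j\<in>K p. gain p j y))"
      using y p by (simp add: nash_def sum.distrib simplex_product_def flip: sum_divide_distrib)
    also have "\<dots> = 1" using pos[of p y] by simp
    finally show ?thesis .
  qed
  then have "x \<in> ?D" using x by (auto simp: simplex_product_def PiE_iff)
  then have "y = x" by (simp add: y_def simplex_retraction_id)
  \<comment> \<open>Multiplying the fixed point equation by its denominator and cancelling the share
    on both sides leaves this proportionality between shares and gains.\<close>
  then have fixy: "y (p, k) * (\<Sum>j\<in>K p. gain p j y) = gain p k y" if "p \<in> P" "k \<in> K p" for p k
    using fixed[of "(p, k)"] that pos[of p y] by (simp add: y_def[symmetric] nash_def field_simps)
  have ynn: "0 \<le> y (p, k)" if "p \<in> P" "k \<in> K p" for p k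
    using y that by (auto simp: simplex_product_def PiE_iff)
  have ysum: "(\<Sum>k\<in>K p. y (p, k)) = 1" if "p \<in> P" for p
    using y that by (simp add: simplex_product_def)
  \<comment> \<open>If some gain is positive, then at a fixed point exactly the routes in use have positive gain, so
    all of them cost less than their own average.\<close>
  have dev: "(\<Sum>k\<in>K p. y (p, k) * (c p k y - avg p y)) = 0" if p: "p \<in> P" for p
    using ysum[OF p] by (simp add: right_diff_distrib sum_subtractf avg_def flip: sum_distrib_right)
  have avg_le: "avg p y \<le> c p j y" if p: "p \<in> P" and j: "j \<in> K p" for p j
  proof (rule ccontr)
    assume "\<not> avg p y \<le> c p j y"
    then have "0 < gain p j y" by (simp add: gain_def)
    then have G: "0 < (\<Sum>j\<in>K p. gain p j y)"
      using fin[OF p] j gain_nonneg by (meson sum_pos2)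
    have cheap: "c p k y < avg p y" if "k \<in> K p" "0 < y (p, k)" for k
    proof -
      have "0 < gain p k y" using fixy[OF p that(1)] G that(2) by (metis mult_pos_pos)
      then show ?thesis by (simp add: gain_def split: if_splits)
    qed
    have "\<exists>k\<in>K p. 0 < y (p, k)"
    proof (rule ccontr)
      assume "\<not> ?thesis"
      then have "(\<Sum>k\<in>K p. y (p, k)) \<le> 0" by (intro sum_nonpos) auto
      then show False using ysum[OF p] by simp
    qed
    then obtain k where k: "k \<in> K p" "0 < y (p, k)" ..
    have "(\<Sum>k\<in>K p. y (p, k) * (c p k y - avg p y)) < (\<Sum>k\<in>K p. 0)"
    proof (rule sum_strict_mono_ex1[OF fin[OF p]])
      show "\<forall>k\<in>K p. y (p, k) * (c p k y - avg p y) \<le> 0"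
      proof
        fix k assume k: "k \<in> K p"
        then show "y (p, k) * (c p k y - avg p y) \<le> 0"
          using ynn[OF p k] cheap[OF k] by (cases "y (p, k) = 0") (auto simp: mult_le_0_iff)
      qed
      show "\<exists>k\<in>K p. y (p, k) * (c p k y - avg p y) < 0"
        using k cheap[OF k] by (auto intro!: bexI[of _ k] simp: mult_less_0_iff)
    qed
    with dev[OF p] show False by simp
  qed
  show ?thesis
  proof (rule that[OF y])
    fix p k j assume p: "p \<in> P" and k: "k \<in> K p" and j: "j \<in> K p" and yk: "y (p, k) > 0"
    \<comment> \<open>By \<open>avg_le\<close> the vanishing sum in \<open>dev\<close> has
      nonnegative terms, so each is 0: whatever is used costs exactly the average, which nothing
      undercuts.\<close>
    have "y (p, k) * (c p k y - avg p y) = 0"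
      using dev[OF p] sum_nonneg_eq_0_iff[OF fin[OF p], of "\<lambda>k. y (p, k) * (c p k y - avg p y)"]
        ynn[OF p] avg_le[OF p] k by simp
    then show "c p k y \<le> c p j y" using yk avg_le[OF p j] by simp
  qed
qed

section \<open>From equilibrium shares to an equilibrium of route flows\<close>

theorem proposition3:
  fixes G :: "('v, 'a) pre_digraph"
    and R S :: "'v set"
    and q :: "'v \<Rightarrow> 'v \<Rightarrow> real"
    and K :: "'v \<Rightarrow> 'v \<Rightarrow> 'a list set"
    and M :: "('a \<Rightarrow> real) \<Rightarrow> 'w measure"
    and T :: "('a \<Rightarrow> real) \<Rightarrow> 'a \<Rightarrow> 'w \<Rightarrow> real"
    and \<alpha> lam :: real
  assumes "stochastic_network G R S q K M T"
    and "0 < \<alpha>" and "\<alpha> < 1"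
    and "0 \<le> lam" and "lam \<le> 1"
    and "\<And>r s k f. r \<in> R \<Longrightarrow> s \<in> S \<Longrightarrow> k \<in> K r s \<Longrightarrow> f \<in> feasible_flows R S q K \<Longrightarrow>
           route_cost G R S K M T \<alpha> lam k f > 0"
    and "\<And>r s k. r \<in> R \<Longrightarrow> s \<in> S \<Longrightarrow> k \<in> K r s \<Longrightarrow>
           continuous_on (feasible_flows R S q K) (route_cost G R S K M T \<alpha> lam k)"
  shows "\<exists>f. combined_mean_equilibrium G R S q K M T \<alpha> lam f"
proof -
  interpret stochastic_network G R S q K M T by fact
  let ?c = "route_cost G R S K M T \<alpha> lam"
  let ?D = "simplex_product (R \<times> S) (\<lambda>(r, s). K r s)"
  \<comment> \<open>Working with shares avoids dividing by the demand: a pair with zero demand still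
    has shares summing to 1, and its flows are 0.\<close>
  define flow where
    "flow y = (\<lambda>(r, s, k)\<in>route_index R S K. q r s * y ((r, s), k))" for y :: "('v \<times> 'v) \<times> 'a list \<Rightarrow> real"
  have flow: "flow y (r, s, k) = q r s * y ((r, s), k)" if "r \<in> R" "s \<in> S" "k \<in> K r s" for y r s k
    using that by (simp add: flow_def route_index_def)
  have flow_feasible: "flow y \<in> feasible_flows R S q K" if "y \<in> ?D" for y
  proof -
    have "(\<Sum>k\<in>K r s. flow y (r, s, k)) = q r s" if "r \<in> R" "s \<in> S" for r s
      using that \<open>y \<in> ?D\<close> by (simp add: flow simplex_product_def flip: sum_distrib_left)
    moreover have "0 \<le> flow y (r, s, k)" if "r \<in> R" "s \<in> S" "k \<in> K r s" for r s k
      using that \<open>y \<in> ?D\<close> demand_nonneg by (auto simp: flow simplex_product_def PiE_iff)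
    ultimately show ?thesis
      by (simp add: feasible_flows_def flow_def)
  qed
  have cont_flow: "continuous_on ?D flow"
    unfolding flow_def restrict_def
  proof (intro continuous_on_coordinatewise_then_product)
    fix i :: "'v \<times> 'v \<times> 'a list"
    obtain r s k where i: "i = (r, s, k)" by (cases i)
    show "continuous_on ?D (\<lambda>y. if i \<in> route_index R S K
        then (case i of (r, s, k) \<Rightarrow> q r s * y ((r, s), k)) else undefined)"
      unfolding i by (cases "(r, s, k) \<in> route_index R S K")
        (auto intro!: continuous_intros continuous_on_coordinate)
  qed
  obtain y where y: "y \<in> ?D"
    and opt: "\<And>p k j. p \<in> R \<times> S \<Longrightarrow> k \<in> (\<lambda>(r, s). K r s) p \<Longrightarrow> j \<in> (\<lambda>(r, s). K r s) p \<Longrightarrow>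
      y (p, k) > 0 \<Longrightarrow> ?c k (flow y) \<le> ?c j (flow y)"
  proof (rule simplex_product_equilibrium[of "R \<times> S" "\<lambda>(r, s). K r s" "\<lambda>p k y. ?c k (flow y)"])
    show "finite (R \<times> S)"
      using origins destinations finite_verts by (metis finite_cartesian_product finite_subset)
    show "continuous_on ?D (\<lambda>y. ?c k (flow y))" if "p \<in> R \<times> S" "k \<in> (case p of (r, s) \<Rightarrow> K r s)" for p k
      using that flow_feasible
      by (auto intro!: continuous_on_compose2[OF assms(7) cont_flow])
  qed (use routes_finite routes_nonempty in auto)
  have "combined_mean_equilibrium G R S q K M T \<alpha> lam (flow y)"
    unfolding combined_mean_equilibrium_def Let_def
  proof (intro conjI ballI)
    fix r s k assume r: "r \<in> R" and s: "s \<in> S" and k: "k \<in> K r s"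
    let ?\<pi> = "Min ((\<lambda>k. ?c k (flow y)) ` K r s)"
    have fin: "finite ((\<lambda>k. ?c k (flow y)) ` K r s)" using routes_finite[OF r s] by simp
    show "0 \<le> ?c k (flow y) - ?\<pi>" using fin k by simp
    show "0 \<le> flow y (r, s, k)" using flow_feasible[OF y] r s k by (simp add: feasible_flows_def)
    \<comment> \<open>Optimality is known for positive shares. It suffices, because a zero share
      makes the flow 0 and the product vanishes anyway.\<close>
    have "?c k (flow y) = ?\<pi>" if "y ((r, s), k) > 0"
      using that opt[of "(r, s)" k] r s k fin by (intro Min_eqI[symmetric]) auto
    moreover have "0 \<le> y ((r, s), k)" using y r s k by (auto simp: simplex_product_def PiE_iff)
    ultimately show "flow y (r, s, k) * (?c k (flow y) - ?\<pi>) = 0"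
      using r s k by (cases "y ((r, s), k) = 0") (auto simp: flow)
  qed (use flow_feasible[OF y] in blast)
  then show ?thesis by blast
qed

end
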